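(* Let $(M,\mathcal F)$ be a Finsler manifold of non-zero constant curvature with $n=\dim M>2$. If the point $x\in M$ is not (semi-)Riemannian, then the curvature algebra $\mathfrak R_x$ at $x$ satisfies $$\dim\mathfrak R_x>\frac{n(n-1)}{2}.$$
   Context: A Minkowski functional on a vector space $V$ is a continuous function $\mathcal F$ on $V$ with $\mathcal F(\lambda y)=\lambda^2\mathcal F(y)$ for $\lambda>0$ (positive homogeneity of degree two), smooth on $\hat V=V\setminus\{0\}$, such that for every $y\in\hat V$ the symmetric bilinear form $g_y(u,v)=g_{ij}(y)u^iv^j=\frac12\frac{\partial^2\mathcal F(y+su+tv)}{\partial s\,\partial t}\big|_{s=t=0}$ is non-degenerate. It is semi-Euclidean if there is a symmetric bilinear form $\langle\,,\rangle$ on $V$ with $g_y(u,v)=\langle u,v\rangle$ for all $y\in\hat V$, $u,v\in V$ (and Euclidean if moreover positive definite). A Finsler manifold $(M,\mathcal F)$ is an $n$-dimensional manifold $M$ with a function $\mathcal F\colon TM\to\mathbb R$, smooth on $\hat TM=TM\setminus\{0\}$, whose restriction $\mathcal F_x=\mathcal F|_{T_xM}$ is a Minkowski functional for every $x\in M$. A point $x\in M$ is (semi-)Riemannian if $\mathcal F_x$ is (semi-)Euclidean. In local coordinates put $G^i(x,y)=\frac14 g^{il}\big(2\frac{\partial g_{jl}}{\partial x^k}-\frac{\partial g_{jk}}{\partial x^l}\big)y^jy^k$, $\Gamma^i_j=\frac{\partial G^i}{\partial y^j}$, and let the curvature tensor be $R_{(x,y)}=R^k_{ij}(x,y)\,dx^i\otimes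 dx^j\otimes\frac{\partial}{\partial y^k}$ with $R^k_{ij}=\frac{\partial\Gamma^k_i}{\partial x^j}-\frac{\partial\Gamma^k_j}{\partial x^i}+\Gamma^m_i\frac{\partial\Gamma^k_j}{\partial y^m}-\Gamma^m_j\frac{\partial\Gamma^k_i}{\partial y^m}$. The manifold is of constant curvature $c\in\mathbb R$ if $R^k_{ij}(x,y)=c\,(\delta^k_i g_{jm}(y)y^m-\delta^k_j g_{im}(y)y^m)$ at every $x\in M$. The indicatrix at $x$ is $\mathfrak I_xM=\{y\in T_xM:\mathcal F(y)=\pm1\}$. For $X,Y\in T_xM$ the curvature vector field $r_x(X,Y)(y)=R^k_{ij}(x,y)X^iY^j\frac{\partial}{\partial y^k}$ is tangent to $\mathfrak I_xM$, hence defines an element of the Lie algebra $\mathfrak X(\mathfrak I_xM)$ of smooth vector fields on $\mathfrak I_xM$. The curvature algebra $\mathfrak R_x$ is the Lie subalgebra of $\mathfrak X(\mathfrak I_xM)$ generated by all curvature vector fields $r_x(X,Y)$, $X,Y\in T_xM$. *)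

theory Defs
  imports "HOL-Analysis.Analysis" "HOL-Library.Function_Algebras" "HOL-Library.Extended_Nat"
begin

section \<open>Linear algebra and smooth maps\<close>

text \<open>Functions into a real vector space form a real vector space under the pointwise operations;
  this makes \<open>subspace\<close>, \<open>span\<close> and \<open>dim\<close> available for spaces of vector fields.\<close>

instantiation "fun" :: (type, real_vector) real_vector
begin

definition scaleR_fun :: "real \<Rightarrow> ('a \<Rightarrow> 'b) \<Rightarrow> 'a \<Rightarrow> 'b" where
  "scaleR_fun c f = (\<lambda>x. c *\<^sub>R f x)"

instance
  by standard (simp_all add: scaleR_fun_def fun_eq_iff scaleR_add_right scaleR_add_left)

end

text \<open>The library function \<open>dim\<close> is a natural number and carries no information for
  infinite-dimensional spaces; the following takes the value \<open>\<infinity>\<close> there.\<close>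

definition edim :: "'v::real_vector set \<Rightarrow> enat" where
  "edim V = (if \<exists>B. finite B \<and> V \<subseteq> span B then enat (dim V) else \<infinity>)"

primrec times_cont_diff_on ::
    "nat \<Rightarrow> 'a::euclidean_space set \<Rightarrow> ('a \<Rightarrow> 'b::real_normed_vector) \<Rightarrow> bool" where
  "times_cont_diff_on 0 S f \<longleftrightarrow> continuous_on S f"
| "times_cont_diff_on (Suc k) S f \<longleftrightarrow>
     (\<forall>x\<in>S. f differentiable (at x)) \<and>
     (\<forall>v. times_cont_diff_on k S (\<lambda>x. frechet_derivative f (at x) v))"

text \<open>Only used for open \<open>S\<close>.\<close>

definition smooth_on :: "'a::euclidean_space set \<Rightarrow> ('a \<Rightarrow> 'b::real_normed_vector) \<Rightarrow> bool" where
  "smooth_on S f \<longleftrightarrow> (\<forall>k. times_cont_diff_on k S f)"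


section \<open>Minkowski functionals\<close>

definition fund_form :: "('v::real_vector \<Rightarrow> real) \<Rightarrow> 'v \<Rightarrow> 'v \<Rightarrow> 'v \<Rightarrow> real" where
  "fund_form F y u v =
     1/2 * deriv (\<lambda>s. deriv (\<lambda>t. F (y + s *\<^sub>R u + t *\<^sub>R v)) 0) 0"

definition minkowski_functional :: "('v::euclidean_space \<Rightarrow> real) \<Rightarrow> bool" where
  "minkowski_functional F \<longleftrightarrow>
     continuous_on UNIV F \<and>
     (\<forall>a>0. \<forall>y. F (a *\<^sub>R y) = a\<^sup>2 * F y) \<and>
     smooth_on (UNIV - {0}) F \<and>
     (\<forall>y. y \<noteq> 0 \<longrightarrow> (\<forall>u. (\<forall>v. fund_form F y u v = 0) \<longrightarrow> u = 0))"

definition semi_euclidean :: "('v::euclidean_space \<Rightarrow> real) \<Rightarrow> bool" where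
  "semi_euclidean F \<longleftrightarrow>
     (\<exists>B. bilinear B \<and> (\<forall>u v. B u v = B v u) \<and>
          (\<forall>y. y \<noteq> 0 \<longrightarrow> (\<forall>u v. fund_form F y u v = B u v)))"

definition indicatrix :: "('v \<Rightarrow> real) \<Rightarrow> 'v set" where
  "indicatrix F = {y. F y = 1 \<or> F y = -1}"


section \<open>Vector fields on the indicatrix\<close>

text \<open>The differential of a Minkowski functional does not vanish on \<open>\<I> = indicatrix F\<close> (by Euler's
  relation), so \<open>\<I>\<close> is a closed hypersurface whose tangent space at \<open>y\<close> is the kernel of
  the differential of \<open>F\<close> at \<open>y\<close>. Vector fields on \<open>\<I>\<close> are extended by \<open>0\<close> outside \<open>\<I>\<close>, so that
  equality of functions is equality of vector fields on \<open>\<I>\<close>.\<close>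

definition indicatrix_fields :: "('v::euclidean_space \<Rightarrow> real) \<Rightarrow> ('v \<Rightarrow> 'v) set" where
  "indicatrix_fields F = {\<xi>.
     (\<forall>y. y \<notin> indicatrix F \<longrightarrow> \<xi> y = 0) \<and>
     (\<forall>y\<in>indicatrix F. frechet_derivative F (at y) (\<xi> y) = 0) \<and>
     (\<forall>y\<in>indicatrix F. \<exists>W \<xi>'. open W \<and> y \<in> W \<and> smooth_on W \<xi>' \<and>
        (\<forall>z\<in>W \<inter> indicatrix F. \<xi>' z = \<xi> z))}"

text \<open>\<open>[\<xi>, \<eta>] = D\<eta>(\<xi>) - D\<xi>(\<eta>)\<close>. A derivative within the hypersurface \<open>\<I>\<close> is not unique as a linear map
  on the ambient space, but its values on tangent vectors are, so the description
  below determines the value for tangent fields.\<close>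

definition field_bracket ::
    "('v::euclidean_space \<Rightarrow> real) \<Rightarrow> ('v \<Rightarrow> 'v) \<Rightarrow> ('v \<Rightarrow> 'v) \<Rightarrow> 'v \<Rightarrow> 'v" where
  "field_bracket F \<xi> \<eta> = (\<lambda>y.
     if y \<in> indicatrix F then
       (THE w. \<exists>D\<xi> D\<eta>. (\<xi> has_derivative D\<xi>) (at y within indicatrix F) \<and>
                       (\<eta> has_derivative D\<eta>) (at y within indicatrix F) \<and>
                       w = D\<eta> (\<xi> y) - D\<xi> (\<eta> y))
     else 0)"

definition lie_subalgebra :: "('v::euclidean_space \<Rightarrow> real) \<Rightarrow> ('v \<Rightarrow> 'v) set \<Rightarrow> bool" where
  "lie_subalgebra F L \<longleftrightarrow>
     L \<subseteq> indicatrix_fields F \<and> subspace L \<and> (\<forall>\<xi>\<in>L. \<forall>\<eta>\<in>L. field_bracket F \<xi> \<eta> \<in> L)"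


section \<open>Curvature in local coordinates\<close>

text \<open>In this section \<open>L x y\<close> is a Finsler function in coordinates: \<open>x\<close> is the position and \<open>y\<close> are the
  induced coordinates of a tangent vector at \<open>x\<close>.\<close>

definition partial :: "'n \<Rightarrow> (real^'n \<Rightarrow> real) \<Rightarrow> real^'n \<Rightarrow> real" where
  "partial i f x = deriv (\<lambda>t. f (x + t *\<^sub>R axis i 1)) 0"

definition metric :: "(real^'n \<Rightarrow> real^'n \<Rightarrow> real) \<Rightarrow> real^'n \<Rightarrow> real^'n \<Rightarrow> real^'n^'n" where
  "metric L x y = (\<chi> i j. fund_form (L x) y (axis i 1) (axis j 1))"

definition geodesic_coeff ::
    "(real^'n::finite \<Rightarrow> real^'n \<Rightarrow> real) \<Rightarrow> 'n \<Rightarrow> real^'n \<Rightarrow> real^'n \<Rightarrow> real" where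
  "geodesic_coeff L i x y =
     1/4 * (\<Sum>l\<in>UNIV. \<Sum>j\<in>UNIV. \<Sum>k\<in>UNIV.
        matrix_inv (metric L x y) $ i $ l *
        (2 * partial k (\<lambda>x'. metric L x' y $ j $ l) x - partial l (\<lambda>x'. metric L x' y $ j $ k) x) *
        y $ j * y $ k)"

definition connection_coeff ::
    "(real^'n::finite \<Rightarrow> real^'n \<Rightarrow> real) \<Rightarrow> 'n \<Rightarrow> 'n \<Rightarrow> real^'n \<Rightarrow> real^'n \<Rightarrow> real" where
  "connection_coeff L i j x y = partial j (\<lambda>y'. geodesic_coeff L i x y') y"

text \<open>\<open>curvature L k i j x y\<close> is the component with upper index \<open>k\<close> and lower indices \<open>i\<close>, \<open>j\<close>.\<close>

definition curvature ::
    "(real^'n::finite \<Rightarrow> real^'n \<Rightarrow> real) \<Rightarrow> 'n \<Rightarrow> 'n \<Rightarrow> 'n \<Rightarrow> real^'n \<Rightarrow> real^'n \<Rightarrow> real" where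
  "curvature L k i j x y =
     partial j (\<lambda>x'. connection_coeff L k i x' y) x
     - partial i (\<lambda>x'. connection_coeff L k j x' y) x
     + (\<Sum>m\<in>UNIV. connection_coeff L m i x y * partial m (\<lambda>y'. connection_coeff L k j x y') y)
     - (\<Sum>m\<in>UNIV. connection_coeff L m j x y * partial m (\<lambda>y'. connection_coeff L k i x y') y)"

definition curvature_field ::
    "(real^'n::finite \<Rightarrow> real^'n \<Rightarrow> real) \<Rightarrow> real^'n \<Rightarrow> real^'n \<Rightarrow> real^'n \<Rightarrow> real^'n \<Rightarrow> real^'n" where
  "curvature_field L x X Y = (\<lambda>y.
     if y \<in> indicatrix (L x)
     then (\<chi> k. \<Sum>i\<in>UNIV. \<Sum>j\<in>UNIV. curvature L k i j x y * X $ i * Y $ j)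
     else 0)"

text \<open>The intersection taken by the \<open>hull\<close> is over a non-empty family: \<open>indicatrix_fields (L x)\<close> is itself
  closed under the bracket and contains the curvature fields.\<close>

definition curvature_algebra ::
    "(real^'n::finite \<Rightarrow> real^'n \<Rightarrow> real) \<Rightarrow> real^'n \<Rightarrow> (real^'n \<Rightarrow> real^'n) set" where
  "curvature_algebra L x = lie_subalgebra (L x) hull {curvature_field L x X Y | X Y. True}"


section \<open>Manifolds and tangent vectors\<close>

text \<open>A chart is a pair of its domain and its coordinate map (irrelevant outside the domain).\<close>

type_synonym ('m, 'n) chart = "'m set \<times> ('m \<Rightarrow> real^'n)"

definition chart_image :: "('m, 'n) chart \<Rightarrow> (real^'n) set" where
  "chart_image c = snd c ` fst c"

definition chart_inv :: "('m, 'n) chart \<Rightarrow> real^'n \<Rightarrow> 'm" where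
  "chart_inv c = inv_into (fst c) (snd c)"

definition smooth_atlas ::
    "('m::{t2_space, second_countable_topology}, 'n::finite) chart set \<Rightarrow> bool" where
  "smooth_atlas A \<longleftrightarrow>
     (\<Union>c\<in>A. fst c) = UNIV \<and>
     (\<forall>c\<in>A. open (fst c) \<and> open (chart_image c) \<and>
        homeomorphism (fst c) (chart_image c) (snd c) (chart_inv c)) \<and>
     (\<forall>c\<in>A. \<forall>d\<in>A. smooth_on (snd c ` (fst c \<inter> fst d)) (snd d \<circ> chart_inv c))"

text \<open>A tangent vector at \<open>p\<close> is the family of its coordinate vectors in all charts around \<open>p\<close>, related
  by the Jacobians of the coordinate changes (and \<open>0\<close> at all other arguments).\<close>

type_synonym ('m, 'n) tangent = "('m, 'n) chart \<Rightarrow> real^'n"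

definition tangent_space ::
    "('m, 'n::finite) chart set \<Rightarrow> 'm \<Rightarrow> ('m, 'n) tangent set" where
  "tangent_space A p = {v.
     (\<forall>c\<in>A. \<forall>d\<in>A. p \<in> fst c \<longrightarrow> p \<in> fst d \<longrightarrow>
        v d = frechet_derivative (snd d \<circ> chart_inv c) (at (snd c p)) (v c)) \<and>
     (\<forall>c. c \<notin> A \<or> p \<notin> fst c \<longrightarrow> v c = 0)}"

definition tangent_of_coords ::
    "('m, 'n::finite) chart set \<Rightarrow> ('m, 'n) chart \<Rightarrow> 'm \<Rightarrow> real^'n \<Rightarrow> ('m, 'n) tangent" where
  "tangent_of_coords A c p = inv_into (tangent_space A p) (\<lambda>v. v c)"


section \<open>Finsler manifolds\<close>

text \<open>A function \<open>F\<close> on the tangent bundle is given as \<open>F p v\<close> for \<open>v \<in> tangent_space A p\<close>; its values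
  at other arguments are irrelevant. \<open>in_coords A F c\<close> is \<open>F\<close> in the coordinates of the tangent bundle
  induced by the chart \<open>c\<close>. For fixed position, these coordinates are a linear isomorphism
  from the tangent space onto \<open>real^'n\<close>; Minkowski functionals, the indicatrix and the curvature algebra
  are transported along it.\<close>

definition in_coords ::
    "('m, 'n::finite) chart set \<Rightarrow> ('m \<Rightarrow> ('m, 'n) tangent \<Rightarrow> real) \<Rightarrow> ('m, 'n) chart \<Rightarrow>
     real^'n \<Rightarrow> real^'n \<Rightarrow> real" where
  "in_coords A F c x y = F (chart_inv c x) (tangent_of_coords A c (chart_inv c x) y)"

definition finsler_manifold ::
    "('m::{t2_space, second_countable_topology}, 'n::finite) chart set \<Rightarrow>
     ('m \<Rightarrow> ('m, 'n) tangent \<Rightarrow> real) \<Rightarrow> bool" where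
  "finsler_manifold A F \<longleftrightarrow>
     smooth_atlas A \<and>
     (\<forall>c\<in>A. smooth_on (chart_image c \<times> (UNIV - {0})) (\<lambda>(x, y). in_coords A F c x y) \<and>
        (\<forall>x\<in>chart_image c. minkowski_functional (in_coords A F c x)))"

definition constant_curvature ::
    "('m, 'n::finite) chart set \<Rightarrow> ('m \<Rightarrow> ('m, 'n) tangent \<Rightarrow> real) \<Rightarrow> real \<Rightarrow> bool" where
  "constant_curvature A F \<kappa> \<longleftrightarrow>
     (\<forall>c\<in>A. \<forall>x\<in>chart_image c. \<forall>y. y \<noteq> 0 \<longrightarrow>
        (let L = in_coords A F c; g = metric L x y in
         \<forall>i j k. curvature L k i j x y =
           \<kappa> * ((if k = i then 1 else 0) * (\<Sum>m\<in>UNIV. g $ j $ m * y $ m)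
              - (if k = j then 1 else 0) * (\<Sum>m\<in>UNIV. g $ i $ m * y $ m))))"

text \<open>Being semi-Euclidean is invariant under linear isomorphisms, so it does not matter
  which chart around \<open>p\<close> is used.\<close>

definition semi_riemannian_point ::
    "('m, 'n::finite) chart set \<Rightarrow> ('m \<Rightarrow> ('m, 'n) tangent \<Rightarrow> real) \<Rightarrow> 'm \<Rightarrow> bool" where
  "semi_riemannian_point A F p \<longleftrightarrow>
     (\<exists>c\<in>A. p \<in> fst c \<and> semi_euclidean (in_coords A F c (snd c p)))"

end

theory Submission
  imports Defs
begin

text \<open>
  Everything happens in one tangent space. Let \<open>F\<close> be the Minkowski functional there, \<open>p\<close> its gradient
  and \<open>H\<close> the derivative of \<open>p\<close>, i.e. the Hessian of \<open>F\<close>. By Euler's relation \<open>p\<close> is twice the covector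
  \<open>g(y, -)\<close>, so constant curvature says that the curvature fields are, up to the non-zero
  factor \<open>\<kappa> / 2\<close>, the restrictions to the indicatrix of \<open>y \<mapsto> (p y \<bullet> Y) X - (p y \<bullet> X) Y\<close>: constant
  skew maps applied to \<open>p\<close> (\<open>curvature_field_eq_linear_field\<close>). Since \<open>H\<close> is invertible, the values of
  \<open>p\<close> satisfy no linear relation, and \<open>n (n - 1) / 2\<close> of these fields are linearly independent
  (\<open>rotations_independent\<close>).

  Suppose the dimension of the curvature algebra does not exceed \<open>n (n - 1) / 2\<close>. Then
  these fields span it, so every bracket of two of them is again a constant linear map applied to \<open>p\<close>.
  For skew \<open>A\<close> and \<open>B\<close> the bracket of \<open>A p\<close> and \<open>B p\<close> is \<open>B H A p - A H B p\<close>. For \<open>n > 2\<close> the components of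
  the brackets of the coordinate fields give
    \<open>p\<^sub>i H\<^sub>j\<^sub>k - p\<^sub>j H\<^sub>i\<^sub>k = c\<^sub>i\<^sub>j\<^sub>k \<bullet> p\<close>   for all \<open>i, j, k\<close>, with constant vectors \<open>c\<^sub>i\<^sub>j\<^sub>k\<close>,
  first on the indicatrix and then, by homogeneity, wherever \<open>F\<close> does not vanish.

  For fixed \<open>k\<close> this reads \<open>p \<and> H\<^sub>k = M\<^sub>k(p)\<close> with \<open>M\<^sub>k\<close> linear into bivectors, hence
  \<open>p \<and> M\<^sub>k(p) = 0\<close>. Differentiating twice and using that \<open>H\<close> is onto, \<open>v \<and> M\<^sub>k(v) = 0\<close> for every
  vector \<open>v\<close>, and exactness of the Koszul complex gives \<open>M\<^sub>k(v) = v \<and> s\<^sub>k\<close> with a constant vector \<open>s\<^sub>k\<close>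
  (\<open>wedge_hessian_splits\<close>). So there is a constant linear map \<open>S\<close> with
  \<open>p \<and> H X = p \<and> S X\<close> for all \<open>X\<close>. Taking \<open>X = y\<close> and \<open>H y = p\<close> yields \<open>p \<and> S y = 0\<close>; the derivative of
  this in direction \<open>X\<close> is \<open>H X \<and> (S y - p) = 0\<close>, and since \<open>H X\<close> is arbitrary, \<open>p = S y\<close>
  (\<open>hessian_gradient_rigid\<close>). By density this holds for all \<open>y \<noteq> 0\<close>, hence \<open>H = S\<close> is constant and
  \<open>F\<close> is semi-Euclidean.
\<close>

section \<open>Symmetry of the second derivative\<close>

lemma has_vector_derivative_along_line:
  assumes "(f has_derivative f') (at (a + s *\<^sub>R v))"
  shows "((\<lambda>t. f (a + t *\<^sub>R v)) has_vector_derivative f' v) (at s)"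
proof -
  have "((\<lambda>t. a + t *\<^sub>R v) has_derivative (\<lambda>t. t *\<^sub>R v)) (at s)"
    by (auto intro!: derivative_eq_intros)
  from has_derivative_compose[OF this assms]
  have "((\<lambda>t. f (a + t *\<^sub>R v)) has_derivative (\<lambda>t. f' (t *\<^sub>R v))) (at s)" .
  moreover have "linear f'"
    using assms has_derivative_linear by blast
  ultimately show ?thesis
    by (simp add: has_vector_derivative_def linear_cmul)
qed

text \<open>The mean value theorem in the direction \<open>v\<close> turns the second difference into a difference of two
  gradients, which the derivative \<open>H\<close> of the gradient approximates. The second difference is symmetric
  in \<open>u\<close> and \<open>v\<close>; this is where the symmetry of \<open>H\<close> comes from.\<close>

lemma second_difference_approx:
  fixes f :: "'a::euclidean_space \<Rightarrow> real"
  assumes r: "r > 0"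
    and grad: "\<And>z. norm (z - x) < r \<Longrightarrow> (f has_derivative (\<lambda>v. P z \<bullet> v)) (at z)"
    and lin: "linear H"
    and app: "\<And>z. norm (z - x) < r \<Longrightarrow> norm (P z - P x - H (z - x)) \<le> e * norm (z - x)"
    and e: "e \<ge> 0"
    and s: "0 < s" "s * (norm u + norm v) < r"
  shows "\<bar>(f (x + s *\<^sub>R u + s *\<^sub>R v) - f (x + s *\<^sub>R u) - f (x + s *\<^sub>R v) + f x) - s\<^sup>2 * (H u \<bullet> v)\<bar>
     \<le> s\<^sup>2 * (e * (2 * (norm u + norm v) * norm v))"
proof -
  let ?\<phi> = "\<lambda>t. f (x + s *\<^sub>R u + t *\<^sub>R v) - f (x + t *\<^sub>R v)"
  have small: "norm (x + a *\<^sub>R u + t *\<^sub>R v - x) \<le> s * (norm u + norm v)"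
    if "0 \<le> t" "t \<le> s" "0 \<le> a" "a \<le> s" for t a
  proof -
    have "norm (a *\<^sub>R u + t *\<^sub>R v) \<le> a * norm u + t * norm v"
      using that norm_triangle_ineq[of "a *\<^sub>R u" "t *\<^sub>R v"] by simp
    also have "\<dots> \<le> s * norm u + s * norm v"
      using that by (intro add_mono mult_right_mono) auto
    finally show ?thesis by (simp add: algebra_simps)
  qed
  have d: "(?\<phi> has_real_derivative ((P (x + s *\<^sub>R u + t *\<^sub>R v) - P (x + t *\<^sub>R v)) \<bullet> v)) (at t)"
    if "0 \<le> t" "t \<le> s" for t
  proof -
    have 1: "norm (x + s *\<^sub>R u + t *\<^sub>R v - x) < r" "norm (x + t *\<^sub>R v - x) < r"
      using small[of t s] small[of t 0] that s by auto
    show ?thesis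
      using DERIV_diff[OF
        has_vector_derivative_along_line[OF grad[OF 1(1)], folded has_real_derivative_iff_has_vector_derivative]
        has_vector_derivative_along_line[OF grad[OF 1(2)], folded has_real_derivative_iff_has_vector_derivative]]
      by (simp add: inner_diff_left)
  qed
  from MVT2[OF s(1), of ?\<phi>, OF d] obtain t where t: "0 < t" "t < s"
    and eq: "?\<phi> s - ?\<phi> 0 = s * ((P (x + s *\<^sub>R u + t *\<^sub>R v) - P (x + t *\<^sub>R v)) \<bullet> v)"
    by auto
  define A where "A = P (x + s *\<^sub>R u + t *\<^sub>R v) - P x - H (s *\<^sub>R u + t *\<^sub>R v)"
  define B where "B = P (x + t *\<^sub>R v) - P x - H (t *\<^sub>R v)"
  have AB: "P (x + s *\<^sub>R u + t *\<^sub>R v) - P (x + t *\<^sub>R v) = A - B + s *\<^sub>R H u"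
    unfolding A_def B_def by (simp add: linear_add[OF lin] linear_cmul[OF lin])
  have "norm A \<le> e * (s * (norm u + norm v))"
    using app[of "x + s *\<^sub>R u + t *\<^sub>R v"] small[of t s] t s e
      mult_left_mono[OF small[of t s] e] by (auto simp: A_def add.assoc)
  moreover have "norm B \<le> e * (s * (norm u + norm v))"
    using app[of "x + t *\<^sub>R v"] small[of t 0] t s e
      mult_left_mono[OF small[of t 0] e] by (auto simp: B_def add.assoc)
  ultimately have nAB: "norm (A - B) \<le> 2 * (e * (s * (norm u + norm v)))"
    using norm_triangle_ineq4[of A B] by linarith
  have "(f (x + s *\<^sub>R u + s *\<^sub>R v) - f (x + s *\<^sub>R u) - f (x + s *\<^sub>R v) + f x) - s\<^sup>2 * (H u \<bullet> v)
      = s * ((A - B) \<bullet> v)"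
    using eq unfolding AB by (simp add: inner_add_left inner_diff_left algebra_simps power2_eq_square)
  also have "\<bar>\<dots>\<bar> \<le> s * (norm (A - B) * norm v)"
    using s Cauchy_Schwarz_ineq2[of "A - B" v] by (simp add: abs_mult)
  also have "\<dots> \<le> s * ((2 * (e * (s * (norm u + norm v)))) * norm v)"
    using nAB s by (intro mult_left_mono mult_right_mono) auto
  finally show ?thesis by (simp add: power2_eq_square algebra_simps)
qed

lemma second_derivative_symmetric:
  fixes f :: "'a::euclidean_space \<Rightarrow> real"
  assumes "open W" "x \<in> W"
    and grad: "\<And>z. z \<in> W \<Longrightarrow> (f has_derivative (\<lambda>v. P z \<bullet> v)) (at z)"
    and H: "(P has_derivative H) (at x)"
  shows "H u \<bullet> v = H v \<bullet> u"
proof (rule ccontr)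
  let ?d = "\<bar>H u \<bullet> v - H v \<bullet> u\<bar>"
  define K where "K = 2 * (norm u + norm v) * (norm u + norm v)"
  assume "H u \<bullet> v \<noteq> H v \<bullet> u"
  then have d: "?d > 0" by simp
  define e where "e = ?d / (2 * (K + 1))"
  have K: "K \<ge> 0" by (simp add: K_def)
  then have e: "e > 0" using d unfolding e_def by (intro divide_pos_pos) auto
  obtain r1 where r1: "r1 > 0" "\<And>z. norm (z - x) < r1 \<Longrightarrow> z \<in> W"
    using assms(1,2) unfolding open_dist dist_norm by blast
  obtain r2 where r2: "r2 > 0"
    "\<And>z. norm (z - x) < r2 \<Longrightarrow> norm (P z - P x - H (z - x)) \<le> e * norm (z - x)"
    using H e unfolding has_derivative_at_alt by blast
  have lin: "linear H" using H has_derivative_linear by blast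
  define r where "r = min r1 r2"
  define s where "s = r / (norm u + norm v + 1)"
  have r: "r > 0" using r1 r2 by (simp add: r_def)
  have s: "s > 0" using r unfolding s_def by (intro divide_pos_pos) (auto simp: add_nonneg_pos)
  have N: "norm u \<ge> 0" "norm v \<ge> 0" by auto
  have "s * (norm u + norm v) < s * (norm u + norm v + 1)"
  proof (rule mult_strict_left_mono[OF _ s])
    show "norm u + norm v < norm u + norm v + 1" by simp
  qed
  also have "\<dots> = r" unfolding s_def
    using N by (simp add: add_nonneg_eq_0_iff)
  finally have sr: "s * (norm u + norm v) < r" .
  have g: "norm (z - x) < r \<Longrightarrow> (f has_derivative (\<lambda>v. P z \<bullet> v)) (at z)"
    and a: "norm (z - x) < r \<Longrightarrow> norm (P z - P x - H (z - x)) \<le> e * norm (z - x)" for z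
    using grad r1 r2 by (auto simp: r_def)
  have D1: "\<bar>(f (x + s *\<^sub>R u + s *\<^sub>R v) - f (x + s *\<^sub>R u) - f (x + s *\<^sub>R v) + f x) - s\<^sup>2 * (H u \<bullet> v)\<bar>
     \<le> s\<^sup>2 * (e * (2 * (norm u + norm v) * norm v))"
    using second_difference_approx[OF r g lin a less_imp_le[OF e] s sr] .
  have D2: "\<bar>(f (x + s *\<^sub>R v + s *\<^sub>R u) - f (x + s *\<^sub>R v) - f (x + s *\<^sub>R u) + f x) - s\<^sup>2 * (H v \<bullet> u)\<bar>
     \<le> s\<^sup>2 * (e * (2 * (norm v + norm u) * norm u))"
    using second_difference_approx[OF r g lin a less_imp_le[OF e] s, of v u] sr by (simp add: add.commute)
  have comm: "x + s *\<^sub>R v + s *\<^sub>R u = x + s *\<^sub>R u + s *\<^sub>R v" by simp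
  have "s\<^sup>2 * ?d = \<bar>s\<^sup>2 * (H u \<bullet> v) - s\<^sup>2 * (H v \<bullet> u)\<bar>"
    by (simp add: abs_mult flip: right_diff_distrib)
  also have "\<dots> \<le> s\<^sup>2 * (e * (2 * (norm u + norm v) * norm v)) + s\<^sup>2 * (e * (2 * (norm v + norm u) * norm u))"
    using D1 D2 unfolding comm by linarith
  also have "\<dots> = s\<^sup>2 * (e * K)" by (simp add: K_def algebra_simps)
  finally have "?d \<le> e * K" using s by simp
  also have "\<dots> \<le> e * (K + 1)" using e by simp
  also have "\<dots> = ?d / 2" using K unfolding e_def by (simp add: add_nonneg_eq_0_iff field_simps)
  finally show False using d by simp
qed

section \<open>Gradient and Hessian of a Minkowski functional\<close>

definition gradient :: "(real^'n::finite \<Rightarrow> real) \<Rightarrow> real^'n \<Rightarrow> real^'n" where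
  "gradient F y = (\<chi> i. frechet_derivative F (at y) (axis i 1))"

definition hessian :: "(real^'n::finite \<Rightarrow> real) \<Rightarrow> real^'n \<Rightarrow> real^'n \<Rightarrow> real^'n" where
  "hessian F y = frechet_derivative (gradient F) (at y)"

lemma open_punctured: "open (UNIV - {0::'a::real_normed_vector})"
  by (simp add: open_delete)

locale minkowski_space =
  fixes F :: "real^'n::finite \<Rightarrow> real"
  assumes minkowski: "minkowski_functional F"
begin

abbreviation p :: "real^'n \<Rightarrow> real^'n" where "p \<equiv> gradient F"
abbreviation H :: "real^'n \<Rightarrow> real^'n \<Rightarrow> real^'n" where "H \<equiv> hessian F"

lemma homogeneous: "a > 0 \<Longrightarrow> F (a *\<^sub>R y) = a\<^sup>2 * F y"
  using minkowski unfolding minkowski_functional_def by blast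

lemma F_zero: "F 0 = 0"
  using homogeneous[of 2 0] by simp

lemma twice_cont_diff: "times_cont_diff_on (Suc (Suc 0)) (UNIV - {0}) F"
  using minkowski unfolding minkowski_functional_def smooth_on_def by blast

lemma F_has_derivative:
  assumes "y \<noteq> 0"
  shows "(F has_derivative (\<lambda>v. p y \<bullet> v)) (at y)"
proof -
  have d: "(F has_derivative frechet_derivative F (at y)) (at y)"
    using twice_cont_diff assms by (subst frechet_derivative_works[symmetric]) simp
  have lin: "linear (frechet_derivative F (at y))"
    using d has_derivative_linear by blast
  have "frechet_derivative F (at y) v = p y \<bullet> v" for v
  proof -
    have "frechet_derivative F (at y) v = frechet_derivative F (at y) (\<Sum>i\<in>UNIV. v $ i *\<^sub>R axis i 1)"
      using basis_expansion[of v] by (simp add: scalar_mult_eq_scaleR)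
    also have "\<dots> = (\<Sum>i\<in>UNIV. v $ i * p y $ i)"
      by (simp add: linear_sum[OF lin] linear_cmul[OF lin] gradient_def)
    finally show ?thesis by (simp add: inner_vec_def mult.commute)
  qed
  then have "frechet_derivative F (at y) = (\<lambda>v. p y \<bullet> v)" by blast
  with d show ?thesis by simp
qed

lemma gradient_has_derivative:
  assumes "y \<noteq> 0"
  shows "(p has_derivative H y) (at y)"
proof -
  have "(\<lambda>z. frechet_derivative F (at z) v) differentiable (at y)" for v
    using twice_cont_diff assms by simp
  then have "p differentiable (at y)"
    unfolding differentiable_componentwise_within[of p]
    by (auto simp: Basis_vec_def inner_axis gradient_def)
  then show ?thesis unfolding hessian_def by (rule iffD1[OF frechet_derivative_works])
qed

lemma hessian_linear: "y \<noteq> 0 \<Longrightarrow> linear (H y)"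
  using gradient_has_derivative has_derivative_linear by blast

lemma hessian_symmetric: "y \<noteq> 0 \<Longrightarrow> H y u \<bullet> v = H y v \<bullet> u"
  by (rule second_derivative_symmetric[OF open_punctured, of y F p])
     (auto intro: F_has_derivative gradient_has_derivative)

text \<open>The inner derivative in \<open>fund_form\<close> is a value of the gradient only as long as \<open>y + s u \<noteq> 0\<close>; this holds
  for small \<open>s\<close>, which is enough for the outer derivative at \<open>0\<close>.\<close>

lemma fund_form_eq_hessian:
  assumes "y \<noteq> 0"
  shows "fund_form F y u v = 1/2 * (H y u \<bullet> v)"
proof -
  have inner: "deriv (\<lambda>t. F (y + s *\<^sub>R u + t *\<^sub>R v)) 0 = p (y + s *\<^sub>R u) \<bullet> v"
    if "y + s *\<^sub>R u \<noteq> 0" for s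
    using has_vector_derivative_along_line[of F _ "y + s *\<^sub>R u" 0 v] F_has_derivative[OF that]
    by (intro DERIV_imp_deriv) (simp add: has_real_derivative_iff_has_vector_derivative)
  have "open {s. y + s *\<^sub>R u \<noteq> 0}"
    by (intro open_Collect_neq continuous_intros)
  then have "\<forall>\<^sub>F s in nhds 0. y + s *\<^sub>R u \<noteq> 0"
    using eventually_nhds_in_open[of "{s. y + s *\<^sub>R u \<noteq> 0}" 0] assms by simp
  then have "\<forall>\<^sub>F s in nhds 0. deriv (\<lambda>t. F (y + s *\<^sub>R u + t *\<^sub>R v)) 0 = p (y + s *\<^sub>R u) \<bullet> v"
    by eventually_elim (rule inner)
  then have "deriv (\<lambda>s. deriv (\<lambda>t. F (y + s *\<^sub>R u + t *\<^sub>R v)) 0) 0 = deriv (\<lambda>s. p (y + s *\<^sub>R u) \<bullet> v) 0"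
    by (rule deriv_cong_ev) simp
  also have "((\<lambda>z. p z \<bullet> v) has_derivative (\<lambda>w. H y w \<bullet> v)) (at (y + 0 *\<^sub>R u))"
    using gradient_has_derivative[OF assms] by (auto intro!: derivative_eq_intros)
  from DERIV_imp_deriv[OF has_vector_derivative_along_line[OF this,
      folded has_real_derivative_iff_has_vector_derivative]]
  have "deriv (\<lambda>s. p (y + s *\<^sub>R u) \<bullet> v) 0 = H y u \<bullet> v" .
  finally show ?thesis by (simp add: fund_form_def)
qed

lemma hessian_inj:
  assumes "y \<noteq> 0" "H y u = 0"
  shows "u = 0"
proof -
  have "\<forall>v. fund_form F y u v = 0"
    using assms by (simp add: fund_form_eq_hessian)
  with assms(1) minkowski show ?thesis
    unfolding minkowski_functional_def by blast
qed

lemma hessian_surj: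
  assumes "y \<noteq> 0" obtains x where "H y x = w"
proof -
  have "inj (H y)"
    using hessian_inj[OF assms] linear_injective_0[OF hessian_linear[OF assms]] by blast
  then have "surj (H y)"
    by (rule linear_inj_imp_surj[OF hessian_linear[OF assms]])
  then show ?thesis using that by (metis surjD)
qed

text \<open>Both sides come from differentiating \<open>z \<mapsto> F (a z) = a\<^sup>2 F z\<close>.\<close>

lemma gradient_homogeneous:
  assumes "y \<noteq> 0" "a > 0"
  shows "p (a *\<^sub>R y) = a *\<^sub>R p y"
proof -
  have ne: "a *\<^sub>R y \<noteq> 0" using assms by simp
  have "((\<lambda>z. a *\<^sub>R z) has_derivative (\<lambda>v. a *\<^sub>R v)) (at y)"
    by (auto intro!: derivative_eq_intros)
  from has_derivative_compose[OF this F_has_derivative[OF ne]]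
  have "((\<lambda>z. a\<^sup>2 * F z) has_derivative (\<lambda>v. a * (p (a *\<^sub>R y) \<bullet> v))) (at y)"
    using assms by (simp add: homogeneous)
  moreover have "((\<lambda>z. a\<^sup>2 * F z) has_derivative (\<lambda>v. a\<^sup>2 * (p y \<bullet> v))) (at y)"
    using F_has_derivative[OF assms(1)] by (auto intro!: derivative_eq_intros)
  ultimately have "(\<lambda>v. a * (p (a *\<^sub>R y) \<bullet> v)) = (\<lambda>v. a\<^sup>2 * (p y \<bullet> v))"
    by (rule has_derivative_unique)
  then have "\<forall>v. p (a *\<^sub>R y) \<bullet> v = (a *\<^sub>R p y) \<bullet> v"
    using assms by (auto simp: fun_eq_iff power2_eq_square)
  then show ?thesis by (metis vector_eq_rdot)
qed

lemma hessian_homogeneous: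
  assumes "y \<noteq> 0" "a > 0"
  shows "H (a *\<^sub>R y) = H y"
proof -
  have ne: "a *\<^sub>R y \<noteq> 0" using assms by simp
  have "((\<lambda>z. a *\<^sub>R z) has_derivative (\<lambda>v. a *\<^sub>R v)) (at y)"
    by (auto intro!: derivative_eq_intros)
  from has_derivative_compose[OF this gradient_has_derivative[OF ne]]
  have "((\<lambda>z. p (a *\<^sub>R z)) has_derivative (\<lambda>v. a *\<^sub>R H (a *\<^sub>R y) v)) (at y)"
    using linear_cmul[OF hessian_linear[OF ne]] by simp
  then have "((\<lambda>z. a *\<^sub>R p z) has_derivative (\<lambda>v. a *\<^sub>R H (a *\<^sub>R y) v)) (at y)"
    by (rule has_derivative_transform_within_open[OF _ open_punctured])
       (use assms in \<open>auto simp: gradient_homogeneous\<close>)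
  moreover have "((\<lambda>z. a *\<^sub>R p z) has_derivative (\<lambda>v. a *\<^sub>R H y v)) (at y)"
    using gradient_has_derivative[OF assms(1)] by (auto intro!: derivative_eq_intros)
  ultimately have "(\<lambda>v. a *\<^sub>R H (a *\<^sub>R y) v) = (\<lambda>v. a *\<^sub>R H y v)"
    by (rule has_derivative_unique)
  then show ?thesis using assms by (auto simp: fun_eq_iff)
qed

text \<open>Differentiate \<open>p ((1 + t) y) = (1 + t) p y\<close> at \<open>t = 0\<close>.\<close>

lemma euler_gradient:
  assumes "y \<noteq> 0"
  shows "H y y = p y"
proof -
  have "(p has_derivative H y) (at (y + 0 *\<^sub>R y))"
    using gradient_has_derivative[OF assms] by simp
  from has_vector_derivative_along_line[OF this]
  have "((\<lambda>t. p (y + t *\<^sub>R y)) has_vector_derivative H y y) (at 0)" .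
  then have "((\<lambda>t. (1 + t) *\<^sub>R p y) has_vector_derivative H y y) (at 0)"
    by (rule has_vector_derivative_transform_within_open[where S = "{-1<..}"])
       (use assms gradient_homogeneous[of y "1 + t" for t] in \<open>auto simp: scaleR_add_left\<close>)
  moreover have "((\<lambda>t. (1 + t) *\<^sub>R p y) has_vector_derivative p y) (at 0)"
    by (auto intro!: derivative_eq_intros)
  ultimately show ?thesis by (rule vector_derivative_unique_at)
qed

lemma gradient_nonzero: "y \<noteq> 0 \<Longrightarrow> p y \<noteq> 0"
  using euler_gradient hessian_inj by metis

text \<open>The cone over the indicatrix. It is open, so that identities on it may be differentiated, and
  identities between homogeneous quantities extend to it from the indicatrix.\<close>

definition cone :: "(real^'n) set" where "cone = {y. F y \<noteq> 0}"

lemma cone_nonzero: "y \<in> cone \<Longrightarrow> y \<noteq> 0"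
  using F_zero by (auto simp: cone_def)

lemma open_cone: "open cone"
proof -
  have "open (F -` (UNIV - {0}))"
    using minkowski unfolding minkowski_functional_def
    by (intro open_vimage[OF open_punctured]) (elim conjE)
  then show ?thesis by (simp add: cone_def vimage_def)
qed

text \<open>If \<open>F\<close> vanished near \<open>y\<close>, its gradient would vanish at \<open>y\<close>, contrary to the non-degeneracy of the
  Hessian and Euler's relation.\<close>

lemma cone_dense:
  assumes "y \<noteq> 0"
  shows "y \<in> closure cone"
proof (rule ccontr)
  assume "y \<notin> closure cone"
  define W where "W = - closure cone - {0}"
  have W: "open W" "y \<in> W"
    using assms \<open>y \<notin> closure cone\<close> by (auto simp: W_def open_delete)
  have "F z = 0" if "z \<in> W" for z
    using that closure_subset[of cone] by (auto simp: W_def cone_def)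
  then have "((\<lambda>z. 0) has_derivative (\<lambda>v. p y \<bullet> v)) (at y)"
    by (rule has_derivative_transform_within_open[OF F_has_derivative[OF assms] W])
  then have "(\<lambda>v. p y \<bullet> v) = (\<lambda>v. 0)"
    by (rule has_derivative_unique) (rule has_derivative_const)
  then have "p y = 0" by (metis inner_eq_zero_iff)
  then show False using gradient_nonzero[OF assms] by simp
qed

lemma indicatrix_cone: "y \<in> indicatrix F \<Longrightarrow> y \<in> cone"
  by (auto simp: indicatrix_def cone_def)

text \<open>Scaling by \<open>1 / sqrt \<bar>F y\<bar>\<close> normalises the value of \<open>F\<close> to its sign.\<close>

lemma cone_over_indicatrix:
  assumes "y \<in> cone"
  obtains a z where "a > 0" "z \<in> indicatrix F" "y = a *\<^sub>R z"
proof
  let ?a = "sqrt \<bar>F y\<bar>"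
  have ne: "\<bar>F y\<bar> > 0" using assms by (simp add: cone_def)
  then show "?a > 0" by simp
  show "y = ?a *\<^sub>R ((1 / ?a) *\<^sub>R y)" using ne by simp
  have "F ((1 / ?a) *\<^sub>R y) = F y / \<bar>F y\<bar>"
    using ne by (subst homogeneous) (auto simp: power_divide)
  then show "(1 / ?a) *\<^sub>R y \<in> indicatrix F"
    using ne by (auto simp: indicatrix_def abs_if)
qed

end

section \<open>Rigidity of the Hessian\<close>

lemma exists_third_index:
  assumes "CARD('n::finite) > 2"
  shows "\<exists>k::'n. k \<noteq> i \<and> k \<noteq> j"
proof (rule ccontr)
  assume "\<nexists>k. k \<noteq> i \<and> k \<noteq> j"
  then have "UNIV = {i, j}" by auto
  moreover have "card {i, j} \<le> 2" by (simp add: card_insert_if)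
  ultimately show False using assms by simp
qed

context minkowski_space begin

lemma derivative_zero_on_cone:
  assumes "\<And>z. z \<in> cone \<Longrightarrow> f z = 0" "y \<in> cone" "(f has_derivative f') (at y)"
  shows "f' x = 0"
proof -
  have "((\<lambda>z. 0) has_derivative f') (at y)"
    by (rule has_derivative_transform_within_open[OF assms(3) open_cone assms(2)]) (rule assms(1))
  then have "f' = (\<lambda>_. 0)"
    by (rule has_derivative_unique) (rule has_derivative_const)
  then show ?thesis by simp
qed

lemma cone_nonempty: "cone \<noteq> {}"
proof -
  have "axis undefined 1 \<noteq> (0 :: real^'n)" by (simp add: axis_eq_0_iff)
  then show ?thesis using cone_dense by fastforce
qed

text \<open>The derivative of \<open>c \<bullet> p\<close> at \<open>y\<close> in a direction \<open>x\<close> is \<open>c \<bullet> H x\<close>, and \<open>H x\<close> can be made equal to \<open>c\<close>.\<close>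

lemma linear_form_vanishes:
  assumes "\<And>y. y \<in> cone \<Longrightarrow> c \<bullet> p y = 0"
  shows "c = 0"
proof -
  obtain y where y: "y \<in> cone" using cone_nonempty by blast
  then have "y \<noteq> 0" by (rule cone_nonzero)
  then obtain x where x: "H y x = c" by (rule hessian_surj)
  have "((\<lambda>z. c \<bullet> p z) has_derivative (\<lambda>x. c \<bullet> H y x)) (at y)"
    using gradient_has_derivative[OF \<open>y \<noteq> 0\<close>] by (rule has_derivative_inner_right)
  from derivative_zero_on_cone[OF assms y this, of x] show ?thesis
    by (simp add: x)
qed

text \<open>Likewise with two derivatives, each of which turns one argument \<open>p y\<close> into an arbitrary vector.\<close>

lemma quadratic_form_vanishes:
  fixes b :: "real^'n \<Rightarrow> real^'n \<Rightarrow> real"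
  assumes b: "bilinear b" and zero: "\<And>y. y \<in> cone \<Longrightarrow> b (p y) (p y) = 0"
  shows "b w w = 0"
proof -
  interpret bounded_bilinear b
    using b by (simp add: bilinear_conv_bounded_bilinear)
  have polar: "b (p y) w + b w (p y) = 0" if y: "y \<in> cone" for y
  proof -
    have "y \<noteq> 0" using y by (rule cone_nonzero)
    then obtain x where x: "H y x = w" by (rule hessian_surj)
    note p' = gradient_has_derivative[OF \<open>y \<noteq> 0\<close>]
    from derivative_zero_on_cone[OF zero y FDERIV[OF p' p'], of x] show ?thesis
      by (simp add: x)
  qed
  obtain y where y: "y \<in> cone" using cone_nonempty by blast
  then have "y \<noteq> 0" by (rule cone_nonzero)
  then obtain x where x: "H y x = w" by (rule hessian_surj)
  note p' = gradient_has_derivative[OF \<open>y \<noteq> 0\<close>]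
  have "((\<lambda>z. b (p z) w + b w (p z)) has_derivative (\<lambda>x. b (H y x) w + b w (H y x))) (at y)"
    by (intro has_derivative_add bounded_linear.has_derivative[OF bounded_linear_left p']
        bounded_linear.has_derivative[OF bounded_linear_right p'])
  from derivative_zero_on_cone[OF polar y this, of x] show ?thesis
    by (simp add: x)
qed

lemma hessian_axis_expansion:
  assumes "y \<noteq> 0"
  shows "H y X $ j = (\<Sum>k\<in>UNIV. X $ k * H y (axis j 1) $ k)"
proof -
  have "H y X $ j = H y X \<bullet> axis j 1" by (simp add: inner_axis)
  also have "\<dots> = H y (axis j 1) \<bullet> X" by (rule hessian_symmetric[OF assms])
  finally show ?thesis by (simp add: inner_vec_def mult.commute)
qed

text \<open>For fixed \<open>k\<close> the vectors \<open>c i j k\<close> are the components of a linear map \<open>M\<close> from vectors to bivectors.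
  The left-hand side of the assumption is a wedge product with \<open>p\<close>, so \<open>p \<and> M(p) = 0\<close>, and therefore
  \<open>v \<and> M(v) = 0\<close> for all \<open>v\<close>. The conclusion is that \<open>M(v) = v \<and> s\<close> for a constant vector \<open>s\<close>,
  an instance of the exactness of the Koszul complex; it is read off by evaluating the
  identity at the basis vectors and at sums of two of them.\<close>

lemma wedge_hessian_splits:
  fixes c :: "'n \<Rightarrow> 'n \<Rightarrow> 'n \<Rightarrow> real^'n"
  assumes c: "\<And>i j k y. y \<in> cone \<Longrightarrow>
      p y $ i * H y (axis j 1) $ k - p y $ j * H y (axis i 1) $ k = c i j k \<bullet> p y"
    and n: "CARD('n) > 2"
  shows "\<exists>s. \<forall>i j k. c i j k = s j k *\<^sub>R axis i 1 - s i k *\<^sub>R axis j 1"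
proof -
  have anti: "c i j k = - c j i k" for i j k
  proof -
    have "(c i j k + c j i k) \<bullet> p y = 0" if "y \<in> cone" for y
      using c[OF that, of i j k] c[OF that, of j i k] by (simp add: inner_add_left)
    then have "c i j k + c j i k = 0" by (rule linear_form_vanishes)
    then show ?thesis by (simp add: eq_neg_iff_add_eq_0)
  qed
  have koszul: "v $ a * (c b d k \<bullet> v) + v $ b * (c d a k \<bullet> v) + v $ d * (c a b k \<bullet> v) = 0" for v a b d k
  proof -
    let ?q = "\<lambda>v w. v $ a * (c b d k \<bullet> w) + v $ b * (c d a k \<bullet> w) + v $ d * (c a b k \<bullet> w)"
    have "bilinear ?q"
      unfolding bilinear_def by (auto intro!: linearI simp: inner_add_right algebra_simps)
    moreover have "?q (p y) (p y) = 0" if "y \<in> cone" for y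
      unfolding c[OF that, symmetric] by (simp add: algebra_simps)
    ultimately show ?thesis by (rule quadratic_form_vanishes)
  qed
  have anti': "c i j k $ m = - (c j i k $ m)" for i j k m
    using anti[of i j k] by (metis vector_uminus_component)
  have axis: "axis a (1::real) $ b = (if b = a then 1 else 0)" for a b :: 'n
    by (simp add: axis_def)
  have off: "c b d k $ a = 0" if "a \<noteq> b" "a \<noteq> d" for a b d k
    using koszul[of "axis a 1" a b d k] that by (simp add: inner_axis axis)
  have diag: "c b d k $ b = c a d k $ a" if "a \<noteq> b" "a \<noteq> d" "b \<noteq> d" for a b d k
  proof -
    have "c b d k $ b + c d a k $ a = 0"
      using koszul[of "axis a 1 + axis b 1" a b d k] that off[of a b d k] off[of b d a k]
      by (simp add: inner_axis inner_add_right axis)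
    then show ?thesis using anti'[of d a k a] by linarith
  qed
  \<comment> \<open>By \<open>diag\<close> the number \<open>c b d k $ b\<close> does not depend on the choice of \<open>b \<noteq> d\<close>; \<open>e d\<close> is one such index.\<close>
  define e where "e d = (SOME b. b \<noteq> d)" for d :: 'n
  have e: "e d \<noteq> d" for d
  proof -
    have "\<exists>b. b \<noteq> d" using exists_third_index[OF n, of d d] by blast
    then show ?thesis unfolding e_def by (rule someI_ex)
  qed
  define s where "s d k = c (e d) d k $ e d" for d k
  have s: "c b d k $ b = s d k" if "b \<noteq> d" for b d k
    using diag[of "e d" b d k] e[of d] that unfolding s_def by metis
  have "c i j k = s j k *\<^sub>R axis i 1 - s i k *\<^sub>R axis j 1" for i j k
  proof (cases "i = j")
    case True
    then have "c i j k $ m = 0" for m using anti'[of i j k m] by simp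
    then show ?thesis using True by (simp add: vec_eq_iff)
  next
    case False
    have "c i j k $ m = (s j k *\<^sub>R axis i 1 - s i k *\<^sub>R axis j 1) $ m" for m
    proof -
      consider "m = i" | "m = j" | "m \<noteq> i" "m \<noteq> j" by blast
      then show ?thesis
      proof cases
        case 1
        then show ?thesis using False s[of i j k] by (simp add: axis)
      next
        case 2
        then show ?thesis using False s[of j i k] anti'[of i j k j] by (simp add: axis)
      next
        case 3
        then show ?thesis using off[of m i j k] by (simp add: axis)
      qed
    qed
    then show ?thesis by (simp add: vec_eq_iff)
  qed
  then show ?thesis by blast
qed

text \<open>The map \<open>S\<close> built from the previous lemma satisfies \<open>p \<and> H X = p \<and> S X\<close> for all \<open>X\<close>. Taking \<open>X = y\<close>
  makes \<open>p\<close> and \<open>S y\<close> parallel, and one more derivative forces them to be equal.\<close>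

lemma hessian_gradient_rigid:
  assumes lin: "\<And>i j k. \<exists>c. \<forall>y\<in>cone.
      p y $ i * H y (axis j 1) $ k - p y $ j * H y (axis i 1) $ k = c \<bullet> p y"
    and n: "CARD('n) > 2"
  obtains S where "linear S" "\<And>y. y \<in> cone \<Longrightarrow> p y = S y"
proof -
  define c where "c i j k = (SOME c. \<forall>y\<in>cone.
      p y $ i * H y (axis j 1) $ k - p y $ j * H y (axis i 1) $ k = c \<bullet> p y)" for i j k
  have c: "p y $ i * H y (axis j 1) $ k - p y $ j * H y (axis i 1) $ k = c i j k \<bullet> p y"
    if "y \<in> cone" for i j k y
    using someI_ex[OF lin[of i j k]] that unfolding c_def by blast
  obtain s where s: "\<forall>i j k. c i j k = s j k *\<^sub>R axis i 1 - s i k *\<^sub>R axis j 1"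
    by (rule exE[OF wedge_hessian_splits[OF c n]])
  define S :: "real^'n \<Rightarrow> real^'n" where "S X = (\<chi> j. \<Sum>k\<in>UNIV. X $ k * s j k)" for X
  have linS: "linear S"
    by (auto intro!: linearI simp: S_def vec_eq_iff sum.distrib sum_distrib_left algebra_simps)
  have wedge: "p y $ i * H y X $ j - p y $ j * H y X $ i = p y $ i * S X $ j - p y $ j * S X $ i"
    if y: "y \<in> cone" for y X i j
  proof -
    have "p y $ i * H y X $ j - p y $ j * H y X $ i
        = (\<Sum>k\<in>UNIV. X $ k * (p y $ i * H y (axis j 1) $ k - p y $ j * H y (axis i 1) $ k))"
      unfolding hessian_axis_expansion[OF cone_nonzero[OF y], of X i]
        hessian_axis_expansion[OF cone_nonzero[OF y], of X j]
      by (simp add: sum_distrib_left sum_subtractf algebra_simps)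
    also have "\<dots> = (\<Sum>k\<in>UNIV. X $ k * (p y $ i * s j k - p y $ j * s i k))"
      unfolding c[OF y] s[rule_format] by (simp add: inner_diff_left inner_axis' mult.commute)
    also have "\<dots> = p y $ i * S X $ j - p y $ j * S X $ i"
      by (simp add: S_def sum_distrib_left sum_subtractf algebra_simps)
    finally show ?thesis .
  qed
  have parallel: "p z $ i * S z $ j - p z $ j * S z $ i = 0" if "z \<in> cone" for z i j
    using wedge[OF that, of i z j] euler_gradient[OF cone_nonzero[OF that]] by simp
  have "p y = S y" if y: "y \<in> cone" for y
  proof -
    have y0: "y \<noteq> 0" using y by (rule cone_nonzero)
    have dS: "(S has_derivative S) (at y)"
      using linS by (simp add: linear_conv_bounded_linear bounded_linear_imp_has_derivative)
    have dSi: "((\<lambda>z. S z $ i) has_derivative (\<lambda>x. S x $ i)) (at y)" for i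
      using bounded_linear.has_derivative[OF bounded_linear_vec_nth dS] .
    have dpi: "((\<lambda>z. p z $ i) has_derivative (\<lambda>x. H y x $ i)) (at y)" for i
      using bounded_linear.has_derivative[OF bounded_linear_vec_nth gradient_has_derivative[OF y0]] .
    \<comment> \<open>The terms \<open>p \<and> S X\<close> in the derivative of \<open>p \<and> S y = 0\<close> are replaced by \<open>p \<and> H X\<close>, which leaves
      \<open>H X \<and> (S y - p) = 0\<close>.\<close>
    have deriv: "H y X $ i * (S y $ j - p y $ j) = H y X $ j * (S y $ i - p y $ i)" for X i j
    proof -
      have "((\<lambda>z. p z $ i * S z $ j - p z $ j * S z $ i) has_derivative
          (\<lambda>x. (p y $ i * S x $ j + H y x $ i * S y $ j) - (p y $ j * S x $ i + H y x $ j * S y $ i))) (at y)"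
        by (intro has_derivative_diff has_derivative_mult dSi dpi)
      from derivative_zero_on_cone[OF parallel y this, of X] wedge[OF y, of i X j]
      show ?thesis by (simp add: algebra_simps)
    qed
    have "p y $ j = S y $ j" for j
    proof -
      obtain i where "i \<noteq> j" using exists_third_index[OF n, of j j] by blast
      moreover obtain X where "H y X = axis i 1" using hessian_surj[OF y0] .
      ultimately show ?thesis using deriv[of X i j] by (simp add: axis_def)
    qed
    then show ?thesis by (simp add: vec_eq_iff)
  qed
  with linS show ?thesis by (rule that)
qed

lemma semi_euclidean_if_gradient_linear:
  assumes S: "linear S" "\<And>y. y \<in> cone \<Longrightarrow> p y = S y"
  shows "semi_euclidean F"
proof -
  have bS: "bounded_linear S" using S(1) by (simp add: linear_conv_bounded_linear)
  have pS: "p y = S y" if y: "y \<noteq> 0" for y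
  proof -
    obtain f where f: "\<And>n. f n \<in> cone" "f \<longlonglongrightarrow> y"
      using cone_dense[OF y] unfolding closure_sequential by blast
    have "(\<lambda>n. p (f n)) \<longlonglongrightarrow> p y"
      using isCont_tendsto_compose[OF has_derivative_continuous[OF gradient_has_derivative[OF y]] f(2)] .
    moreover have "(\<lambda>n. p (f n)) \<longlonglongrightarrow> S y"
      using bounded_linear.tendsto[OF bS f(2)] S(2)[OF f(1)] by simp
    ultimately show ?thesis by (rule LIMSEQ_unique)
  qed
  have HS: "H y = S" if "y \<noteq> 0" for y
  proof -
    have "(S has_derivative H y) (at y)"
      by (rule has_derivative_transform_within_open[OF gradient_has_derivative[OF that] open_punctured])
         (use that pS in auto)
    then show ?thesis
      by (rule has_derivative_unique) (rule bounded_linear_imp_has_derivative[OF bS])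
  qed
  obtain y0 :: "real^'n" where y0: "y0 \<noteq> 0" using cone_nonempty cone_nonzero by blast
  have "bilinear (\<lambda>u v. 1/2 * (S u \<bullet> v))"
    unfolding bilinear_def
    by (auto intro!: linearI simp: linear_add[OF S(1)] linear_cmul[OF S(1)] inner_add_left inner_add_right algebra_simps)
  moreover have "1/2 * (S u \<bullet> v) = 1/2 * (S v \<bullet> u)" for u v
    using hessian_symmetric[OF y0] HS[OF y0] by simp
  moreover have "fund_form F y u v = 1/2 * (S u \<bullet> v)" if "y \<noteq> 0" for y u v
    using fund_form_eq_hessian[OF that] HS[OF that] by simp
  ultimately show ?thesis unfolding semi_euclidean_def by blast
qed

end

section \<open>Brackets of curvature fields\<close>

text \<open>The skew map corresponding to \<open>X \<and> Y\<close>. Applied to the gradient it gives the curvature field of a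
  space of constant curvature, up to a constant factor.\<close>

definition bivector :: "'a::real_inner \<Rightarrow> 'a \<Rightarrow> 'a \<Rightarrow> 'a" where
  "bivector X Y v = (v \<bullet> Y) *\<^sub>R X - (v \<bullet> X) *\<^sub>R Y"

lemma linear_bivector: "linear (bivector X Y)"
  by (auto intro!: linearI simp: bivector_def inner_add_left algebra_simps)

lemma bivector_skew: "v \<bullet> bivector X Y v = 0"
  by (simp add: bivector_def inner_diff_right)

context minkowski_space begin

text \<open>Rescaling the straight line \<open>y + t v\<close> so that \<open>F\<close> keeps the value \<open>F y\<close> gives a curve in the
  indicatrix. For tangent \<open>v\<close> the scaling factor has derivative \<open>0\<close> at \<open>t = 0\<close>, so the velocity is
  still \<open>v\<close>.\<close>

lemma curve_in_indicatrix:
  assumes y: "y \<in> indicatrix F" and v: "p y \<bullet> v = 0"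
  obtains c W where "open W" "0 \<in> W" "\<And>t. t \<in> W \<Longrightarrow> c t \<in> indicatrix F"
    "c 0 = y" "(c has_derivative (\<lambda>t. t *\<^sub>R v)) (at (0::real))"
proof -
  have Fy: "F y \<noteq> 0" using indicatrix_cone[OF y] by (simp add: cone_def)
  have y0: "y \<noteq> 0" using indicatrix_cone[OF y] by (rule cone_nonzero)
  define g where "g t = F (y + t *\<^sub>R v) / F y" for t
  define c where "c t = (1 / sqrt (g t)) *\<^sub>R (y + t *\<^sub>R v)" for t
  define W where "W = {t. 0 < g t}"
  have contF: "continuous_on UNIV F"
    using minkowski unfolding minkowski_functional_def by (elim conjE)
  have "continuous_on UNIV (\<lambda>t. F (y + t *\<^sub>R v))"
    by (rule continuous_on_compose2[OF contF]) (auto intro!: continuous_intros)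
  then have "continuous_on UNIV g"
    unfolding g_def using Fy by (intro continuous_intros) auto
  then have "open W"
    unfolding W_def by (intro open_Collect_less continuous_intros)
  moreover have g0: "g 0 = 1" using Fy by (simp add: g_def)
  then have "0 \<in> W" by (simp add: W_def)
  moreover have "c t \<in> indicatrix F" if "t \<in> W" for t
  proof -
    have pos: "g t > 0" using that by (simp add: W_def)
    then have "F (c t) = (1 / sqrt (g t))\<^sup>2 * F (y + t *\<^sub>R v)"
      unfolding c_def by (intro homogeneous) simp
    also have "\<dots> = F (y + t *\<^sub>R v) / g t"
      using pos by (simp add: power_divide)
    also have "\<dots> = F y"
      using pos Fy by (auto simp: g_def)
    finally show ?thesis using y by (simp add: indicatrix_def)
  qed
  moreover have "c 0 = y" by (simp add: c_def g0)
  moreover have "(c has_derivative (\<lambda>t. t *\<^sub>R v)) (at 0)"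
  proof -
    have "((\<lambda>t. F (y + t *\<^sub>R v)) has_real_derivative 0) (at 0)"
      using has_vector_derivative_along_line[of F "\<lambda>v. p y \<bullet> v" y 0 v] F_has_derivative[OF y0] v
      by (simp add: has_real_derivative_iff_has_vector_derivative)
    then have "(g has_real_derivative 0) (at 0)"
      unfolding g_def using DERIV_cdivide by fastforce
    then have "((\<lambda>t. inverse (sqrt (g t))) has_real_derivative 0) (at 0)"
      by (auto intro!: derivative_eq_intros simp: g0)
    then have "((\<lambda>t. 1 / sqrt (g t)) has_derivative (\<lambda>t. 0)) (at 0)"
      by (simp add: has_field_derivative_def inverse_eq_divide lambda_zero)
    moreover have "((\<lambda>t. y + t *\<^sub>R v) has_derivative (\<lambda>t. t *\<^sub>R v)) (at 0)"
      by (auto intro!: derivative_eq_intros)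
    ultimately have "((\<lambda>t. (1 / sqrt (g t)) *\<^sub>R (y + t *\<^sub>R v)) has_derivative
        (\<lambda>t. (1 / sqrt (g 0)) *\<^sub>R (t *\<^sub>R v) + 0 *\<^sub>R (y + 0 *\<^sub>R v))) (at 0)"
      by (rule has_derivative_scaleR)
    then show ?thesis by (simp add: c_def[abs_def] g0)
  qed
  ultimately show ?thesis by (rule that)
qed

text \<open>Along a curve in the indicatrix with velocity \<open>v\<close> the chain rule determines \<open>D v\<close>. This makes the
  description in \<open>field_bracket\<close> unique for tangent fields.\<close>

lemma tangential_derivative_unique:
  assumes y: "y \<in> indicatrix F" and v: "p y \<bullet> v = 0"
    and D: "(\<xi> has_derivative D) (at y within indicatrix F)"
    and D': "(\<xi> has_derivative D') (at y within indicatrix F)"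
  shows "D v = D' v"
proof -
  obtain c W where W: "open W" "0 \<in> W" and c: "\<And>t. t \<in> W \<Longrightarrow> c t \<in> indicatrix F" "c 0 = y"
    and c': "(c has_derivative (\<lambda>t. t *\<^sub>R v)) (at (0::real))"
    by (rule curve_in_indicatrix[OF y v]) blast
  have sub: "c ` W \<subseteq> indicatrix F" using c(1) by blast
  have comp: "((\<lambda>t. \<xi> (c t)) has_derivative (\<lambda>t. E (t *\<^sub>R v))) (at 0)"
    if "(\<xi> has_derivative E) (at y within indicatrix F)" for E
    using has_derivative_in_compose[of c "\<lambda>t. t *\<^sub>R v" 0 W \<xi> E]
      has_derivative_at_withinI[OF c'] has_derivative_subset[OF that sub] c(2) at_within_open[OF W(2,1)]
    by simp
  have "(\<lambda>t. D (t *\<^sub>R v)) = (\<lambda>t. D' (t *\<^sub>R v))"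
    by (rule has_derivative_unique[OF comp[OF D] comp[OF D']])
  then have "D (1 *\<^sub>R v) = D' (1 *\<^sub>R v)" by (rule fun_cong)
  then show ?thesis by simp
qed

text \<open>Since \<open>p y\<close> is normal to the indicatrix, skew maps \<open>C\<close> give tangent fields. The value \<open>0\<close> outside the
  indicatrix is the convention for its vector fields.\<close>

definition linear_field :: "(real^'n \<Rightarrow> real^'n) \<Rightarrow> real^'n \<Rightarrow> real^'n" where
  "linear_field C y = (if y \<in> indicatrix F then C (p y) else 0)"

lemma linear_field_has_derivative:
  assumes "linear C" "y \<in> indicatrix F"
  shows "(linear_field C has_derivative (\<lambda>x. C (H y x))) (at y within indicatrix F)"
proof -
  have y0: "y \<noteq> 0" using indicatrix_cone[OF assms(2)] by (rule cone_nonzero)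
  have "bounded_linear C" using assms(1) by (simp add: linear_conv_bounded_linear)
  then have "((\<lambda>z. C (p z)) has_derivative (\<lambda>x. C (H y x))) (at y within indicatrix F)"
    using has_derivative_at_withinI[OF gradient_has_derivative[OF y0]] by (rule bounded_linear.has_derivative)
  then show ?thesis
    by (rule has_derivative_transform[rotated 2]) (use assms(2) in \<open>auto simp: linear_field_def\<close>)
qed

lemma bracket_linear_fields:
  assumes A: "linear A" "\<And>v. v \<bullet> A v = 0" and B: "linear B" "\<And>v. v \<bullet> B v = 0"
    and y: "y \<in> indicatrix F"
  shows "field_bracket F (linear_field A) (linear_field B) y = B (H y (A (p y))) - A (H y (B (p y)))"
proof -
  let ?A = "\<lambda>x. A (H y x)" and ?B = "\<lambda>x. B (H y x)"
  have val: "linear_field A y = A (p y)" "linear_field B y = B (p y)"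
    using y by (auto simp: linear_field_def)
  note dA = linear_field_has_derivative[OF A(1) y] and dB = linear_field_has_derivative[OF B(1) y]
  have "(THE w. \<exists>D\<xi> D\<eta>. (linear_field A has_derivative D\<xi>) (at y within indicatrix F) \<and>
                       (linear_field B has_derivative D\<eta>) (at y within indicatrix F) \<and>
                       w = D\<eta> (linear_field A y) - D\<xi> (linear_field B y)) = ?B (A (p y)) - ?A (B (p y))"
  proof (rule the_equality)
    show "\<exists>D\<xi> D\<eta>. (linear_field A has_derivative D\<xi>) (at y within indicatrix F) \<and>
                  (linear_field B has_derivative D\<eta>) (at y within indicatrix F) \<and>
                  ?B (A (p y)) - ?A (B (p y)) = D\<eta> (linear_field A y) - D\<xi> (linear_field B y)"
      using val by (intro exI[of _ ?A] exI[of _ ?B] conjI dA dB) simp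
  next
    fix w
    assume "\<exists>D\<xi> D\<eta>. (linear_field A has_derivative D\<xi>) (at y within indicatrix F) \<and>
                  (linear_field B has_derivative D\<eta>) (at y within indicatrix F) \<and>
                  w = D\<eta> (linear_field A y) - D\<xi> (linear_field B y)"
    then obtain D1 D2 where "(linear_field A has_derivative D1) (at y within indicatrix F)"
      "(linear_field B has_derivative D2) (at y within indicatrix F)"
      and w: "w = D2 (linear_field A y) - D1 (linear_field B y)" by blast
    then have "D1 (B (p y)) = ?A (B (p y))" "D2 (A (p y)) = ?B (A (p y))"
      using tangential_derivative_unique[OF y _ _ dA] tangential_derivative_unique[OF y _ _ dB] A(2) B(2)
      by blast+
    then show "w = ?B (A (p y)) - ?A (B (p y))" using w val by simp
  qed
  then show ?thesis using y by (simp add: field_bracket_def)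
qed

text \<open>Both sides are homogeneous of degree one, since \<open>p\<close> is and \<open>H\<close> is homogeneous of degree zero.\<close>

lemma homogeneous_extension:
  assumes lin: "linear C" "linear A" "linear B"
    and eq: "\<And>y. y \<in> indicatrix F \<Longrightarrow> C (p y) = B (H y (A (p y))) - A (H y (B (p y)))"
    and y: "y \<in> cone"
  shows "C (p y) = B (H y (A (p y))) - A (H y (B (p y)))"
proof -
  obtain a z where a: "a > 0" and z: "z \<in> indicatrix F" and yz: "y = a *\<^sub>R z"
    using cone_over_indicatrix[OF y] by blast
  have z0: "z \<noteq> 0" using indicatrix_cone[OF z] by (rule cone_nonzero)
  show ?thesis
    unfolding yz gradient_homogeneous[OF z0 a] hessian_homogeneous[OF z0 a]
      linear_cmul[OF lin(1)] linear_cmul[OF lin(2)] linear_cmul[OF lin(3)] linear_cmul[OF hessian_linear[OF z0]]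
      eq[OF z] by (simp add: scaleR_diff_right)
qed

text \<open>The bracket of the fields of \<open>e\<^sub>i \<and> e\<^sub>j\<close> and \<open>e\<^sub>j \<and> e\<^sub>k\<close>. The two components shown are minors
  \<open>p\<^sub>a H\<^sub>b\<^sub>c - p\<^sub>b H\<^sub>a\<^sub>c\<close> in which the index \<open>c\<close> equals \<open>b\<close> (component \<open>k\<close>) or differs from both \<open>a\<close> and \<open>b\<close>
  (component \<open>j\<close>). The second kind needs the symmetry of \<open>H\<close>.\<close>

lemma bracket_axis_components:
  fixes i j k :: 'n
  assumes "y \<noteq> 0" "i \<noteq> j" "j \<noteq> k" "i \<noteq> k"
  defines "E \<equiv> bivector (axis j 1) (axis k 1) (H y (bivector (axis i 1) (axis j 1) (p y)))
     - bivector (axis i 1) (axis j 1) (H y (bivector (axis j 1) (axis k 1) (p y)))"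
  shows "E $ k = p y $ i * H y (axis j 1) $ j - p y $ j * H y (axis i 1) $ j"
    and "E $ j = p y $ k * H y (axis i 1) $ j - p y $ i * H y (axis k 1) $ j"
proof -
  note lin = hessian_linear[OF assms(1)]
  have sym: "H y (axis a 1) $ b = H y (axis b 1) $ a" for a b
    using hessian_symmetric[OF assms(1), of "axis a 1" "axis b 1"] by (simp add: inner_axis)
  have axis: "axis a (1::real) $ b = (if b = a then 1 else 0)" for a b :: 'n
    by (simp add: axis_def)
  note s = linear_diff[OF lin] linear_cmul[OF lin] inner_axis axis
  show "E $ k = p y $ i * H y (axis j 1) $ j - p y $ j * H y (axis i 1) $ j"
    using assms(2-4) by (simp add: E_def bivector_def s algebra_simps)
  show "E $ j = p y $ k * H y (axis i 1) $ j - p y $ i * H y (axis k 1) $ j"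
    using assms(2-4) sym[of i k] sym[of j k] sym[of i j] by (simp add: E_def bivector_def s algebra_simps)
qed

text \<open>A third index is needed both for the bracket in \<open>bracket_axis_components\<close> to exist and for reading off
  the minors with a repeated index. In dimension two the fields span a line and closedness under the
  bracket says nothing.\<close>

lemma semi_euclidean_if_brackets_linear:
  assumes n: "CARD('n) > 2"
    and closed: "\<And>X Y Z W. \<exists>C. linear C \<and>
      field_bracket F (linear_field (bivector X Y)) (linear_field (bivector Z W)) = linear_field C"
  shows "semi_euclidean F"
proof -
  have brack: "\<exists>C. linear C \<and> (\<forall>y\<in>cone. C (p y)
      = bivector (axis j 1) (axis k 1) (H y (bivector (axis i 1) (axis j 1) (p y)))
      - bivector (axis i 1) (axis j 1) (H y (bivector (axis j 1) (axis k 1) (p y))))" for i j k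
  proof -
    let ?A = "bivector (axis i 1) (axis j 1) :: real^'n \<Rightarrow> real^'n"
    let ?B = "bivector (axis j 1) (axis k 1) :: real^'n \<Rightarrow> real^'n"
    obtain C where C: "linear C" "field_bracket F (linear_field ?A) (linear_field ?B) = linear_field C"
      using closed by blast
    have "C (p y) = ?B (H y (?A (p y))) - ?A (H y (?B (p y)))" if "y \<in> indicatrix F" for y
      using bracket_linear_fields[OF linear_bivector bivector_skew linear_bivector bivector_skew that] C(2) that
      by (metis linear_field_def)
    then have "C (p y) = ?B (H y (?A (p y))) - ?A (H y (?B (p y)))" if "y \<in> cone" for y
      using homogeneous_extension[OF C(1) linear_bivector linear_bivector _ that] by blast
    then show ?thesis using C(1) by blast
  qed
  have comp: "C v $ k = adjoint C (axis k 1) \<bullet> v" if "linear C" for C :: "real^'n \<Rightarrow> real^'n" and v k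
    using adjoint_works[OF that, of v "axis k 1"] by (simp add: inner_axis inner_commute)
  let ?star = "\<lambda>i j k. \<exists>c. \<forall>y\<in>cone.
      p y $ i * H y (axis j 1) $ k - p y $ j * H y (axis i 1) $ k = c \<bullet> p y"
  have swap: "?star j i k" if ij: "?star i j k" for i j k
  proof -
    obtain c where c: "\<forall>y\<in>cone. p y $ i * H y (axis j 1) $ k - p y $ j * H y (axis i 1) $ k = c \<bullet> p y"
      using ij by blast
    have "\<forall>y\<in>cone. p y $ j * H y (axis i 1) $ k - p y $ i * H y (axis j 1) $ k = (- c) \<bullet> p y"
      using c by (metis inner_minus_left minus_diff_eq)
    then show ?thesis by blast
  qed
  have distinct: "?star i j k" if "i \<noteq> j" "j \<noteq> k" "i \<noteq> k" for i j k
  proof -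
    obtain C where C: "linear C" "\<forall>y\<in>cone. C (p y)
      = bivector (axis k 1) (axis i 1) (H y (bivector (axis j 1) (axis k 1) (p y)))
      - bivector (axis j 1) (axis k 1) (H y (bivector (axis k 1) (axis i 1) (p y)))"
      using brack by blast
    have "p y $ i * H y (axis j 1) $ k - p y $ j * H y (axis i 1) $ k = adjoint C (axis k 1) \<bullet> p y"
      if y: "y \<in> cone" for y
      using bracket_axis_components(2)[OF cone_nonzero[OF y], of j k i] C(2) y \<open>i \<noteq> j\<close> \<open>j \<noteq> k\<close> \<open>i \<noteq> k\<close>
        comp[OF C(1), of "p y" k] by metis
    then show ?thesis by blast
  qed
  have diagonal: "?star i j j" if "i \<noteq> j" for i j
  proof -
    obtain k where k: "k \<noteq> i" "k \<noteq> j" using exists_third_index[OF n, of i j] by blast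
    obtain C where C: "linear C" "\<forall>y\<in>cone. C (p y)
      = bivector (axis j 1) (axis k 1) (H y (bivector (axis i 1) (axis j 1) (p y)))
      - bivector (axis i 1) (axis j 1) (H y (bivector (axis j 1) (axis k 1) (p y)))"
      using brack by blast
    have "p y $ i * H y (axis j 1) $ j - p y $ j * H y (axis i 1) $ j = adjoint C (axis k 1) \<bullet> p y"
      if y: "y \<in> cone" for y
      using bracket_axis_components(1)[OF cone_nonzero[OF y], of i j k] C(2) y \<open>i \<noteq> j\<close> k
        comp[OF C(1), of "p y" k] by metis
    then show ?thesis by blast
  qed
  have "?star i j k" for i j k
  proof -
    consider "i = j" | "i \<noteq> j" "k = j" | "i \<noteq> j" "k = i" | "i \<noteq> j" "j \<noteq> k" "i \<noteq> k" by blast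
    then show ?thesis
    proof cases
      case 1
      then show ?thesis by (intro exI[of _ 0]) simp
    next
      case 2
      then show ?thesis using diagonal by blast
    next
      case 3
      then show ?thesis using swap[of j i i] diagonal[of j i] by blast
    next
      case 4
      then show ?thesis by (rule distinct)
    qed
  qed
  from hessian_gradient_rigid[OF this n] obtain S where "linear S" "\<And>y. y \<in> cone \<Longrightarrow> p y = S y"
    by blast
  then show ?thesis by (rule semi_euclidean_if_gradient_linear)
qed

end

section \<open>Dimension of the curvature algebra\<close>

lemma sum_fun_apply: "(\<Sum>x\<in>A. f x) y = (\<Sum>x\<in>A. f x y)"
proof (induction A rule: infinite_finite_induct)
qed (simp_all only: sum.infinite sum.empty sum.insert zero_fun_apply plus_fun_apply not_False_eq_True if_True simp_thms)

text \<open>A vector outside \<open>span B\<close> would enlarge \<open>B\<close> to an independent set with more elements than a basis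
  of \<open>V\<close>.\<close>

lemma subset_span_if_edim_le_card:
  fixes V :: "'v::real_vector set"
  assumes V: "edim V \<le> enat (card B)"
    and B: "finite B" "independent B" "B \<subseteq> V"
  shows "V \<subseteq> span B"
proof
  obtain B0 where B0: "finite B0" "V \<subseteq> span B0" and dim: "dim V \<le> card B"
    using V by (auto simp: edim_def split: if_splits)
  obtain D where D: "D \<subseteq> V" "independent D" "V \<subseteq> span D" "card D = dim V"
    by (rule basis_exists)
  have finD: "finite D"
    using independent_span_bound[OF B0(1) D(2)] D(1) B0(2) by blast
  fix v assume v: "v \<in> V"
  show "v \<in> span B"
  proof (rule ccontr)
    assume nv: "v \<notin> span B"
    then have "independent (insert v B)" using B(2) by (rule independent_insertI)
    moreover have "insert v B \<subseteq> span D" using v B(3) D(3) by blast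
    ultimately have "card (insert v B) \<le> card D"
      using independent_span_bound[OF finD] by blast
    moreover have "v \<notin> B" using nv span_base by blast
    ultimately show False using B(1) D(4) dim by simp
  qed
qed

text \<open>An injection into the naturals orders the index type; the pairs \<open>i < j\<close> index the coordinate planes.\<close>

lemma card_less_pairs:
  fixes f :: "'n::finite \<Rightarrow> nat"
  assumes "inj f"
  shows "card {(i, j). f i < f j} = CARD('n) * (CARD('n) - 1) div 2"
proof -
  let ?L = "{(i, j). f i < f j}" and ?G = "{(i, j). f j < f i}" and ?D = "{(i, j). f i = f j}"
  have "?G = prod.swap ` ?L" by (auto simp: image_iff)
  then have G: "card ?G = card ?L" by (simp add: card_image)
  have "?D = (\<lambda>i. (i, i)) ` UNIV" using assms by (auto simp: inj_def)
  then have D: "card ?D = CARD('n)" by (simp add: card_image inj_on_def)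
  have "(UNIV :: ('n \<times> 'n) set) = ?L \<union> ?G \<union> ?D" by auto
  then have "CARD('n \<times> 'n) = card (?L \<union> ?G \<union> ?D)" by simp
  also have "\<dots> = card (?L \<union> ?G) + card ?D" by (rule card_Un_disjoint) auto
  also have "card (?L \<union> ?G) = card ?L + card ?G" by (rule card_Un_disjoint) auto
  finally have "CARD('n) * CARD('n) = 2 * card ?L + CARD('n)" using G D by simp
  then have "CARD('n) * (CARD('n) - 1) = 2 * card ?L" by (simp add: diff_mult_distrib2)
  then show ?thesis by simp
qed

text \<open>The hull is an intersection of subalgebras, so it inherits closure properties from them.\<close>

lemma subspace_lie_hull: "subspace (lie_subalgebra F hull G)"
  unfolding hull_def
proof (rule subspace_Inter)
  show "\<forall>L\<in>{L. lie_subalgebra F L \<and> G \<subseteq> L}. subspace L"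
    unfolding lie_subalgebra_def by blast
qed

lemma bracket_lie_hull:
  assumes "\<xi> \<in> lie_subalgebra F hull G" "\<eta> \<in> lie_subalgebra F hull G"
  shows "field_bracket F \<xi> \<eta> \<in> lie_subalgebra F hull G"
  unfolding hull_def
proof (rule InterI)
  fix L assume "L \<in> {L. lie_subalgebra F L \<and> G \<subseteq> L}"
  moreover from this have "\<xi> \<in> L" "\<eta> \<in> L"
    using assms unfolding hull_def by blast+
  ultimately show "field_bracket F \<xi> \<eta> \<in> L"
    by (simp add: lie_subalgebra_def)
qed

context minkowski_space begin

lemma linear_field_add: "linear_field A + linear_field B = linear_field (\<lambda>v. A v + B v)"
proof
  show "(linear_field A + linear_field B) y = linear_field (\<lambda>v. A v + B v) y" for y
    by (simp add: linear_field_def)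
qed

lemma linear_field_scaleR: "a *\<^sub>R linear_field A = linear_field (\<lambda>v. a *\<^sub>R A v)"
proof
  show "(a *\<^sub>R linear_field A) y = linear_field (\<lambda>v. a *\<^sub>R A v) y" for y
    unfolding linear_field_def scaleR_fun_def by simp
qed

lemma subspace_linear_fields: "subspace {linear_field C | C. linear C}"
proof (rule subspaceI)
  have "0 = linear_field (\<lambda>v. 0)" by (auto simp: linear_field_def fun_eq_iff)
  then show "0 \<in> {linear_field C | C. linear C}" using linear_zero by blast
next
  fix x y assume "x \<in> {linear_field C | C. linear C}" "y \<in> {linear_field C | C. linear C}"
  then show "x + y \<in> {linear_field C | C. linear C}"
    using linear_compose_add linear_field_add by fastforce
next
  fix c :: real and x assume "x \<in> {linear_field C | C. linear C}"
  then show "c *\<^sub>R x \<in> {linear_field C | C. linear C}"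
    using linear_compose_scale_right linear_field_scaleR by fastforce
qed

abbreviation rotation :: "'n \<times> 'n \<Rightarrow> real^'n \<Rightarrow> real^'n" where
  "rotation \<equiv> \<lambda>(i, j). linear_field (bivector (axis i 1) (axis j 1))"

text \<open>The \<open>k\<close>-th component of the combination is \<open>c \<bullet> p\<close> for a constant vector \<open>c\<close> whose \<open>l\<close>-th entry is
  the coefficient at \<open>(k, l)\<close>. It vanishes on the indicatrix, hence on the cone, hence \<open>c = 0\<close>.\<close>

lemma rotations_independent:
  fixes f :: "'n \<Rightarrow> nat"
  assumes f: "inj f" and P: "P = {(i, j). f i < f j}"
    and zero: "(\<Sum>q\<in>P. a q *\<^sub>R rotation q) = 0" and q: "q \<in> P"
  shows "a q = 0"
proof -
  obtain k l where kl: "q = (k, l)" "f k < f l" using q P by blast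
  define c :: "real^'n" where "c = (\<Sum>(i, j)\<in>P. a (i, j) *\<^sub>R
    ((if i = k then axis j 1 else 0) - (if j = k then axis i 1 else 0)))"
  have axis: "axis i (1::real) $ j = (if j = i then 1 else 0)" for i j :: 'n
    by (simp add: axis_def)
  have on_indicatrix: "c \<bullet> p y = 0" if y: "y \<in> indicatrix F" for y
  proof -
    have "0 = (\<Sum>q\<in>P. a q *\<^sub>R rotation q) y $ k" by (simp add: zero)
    also have "\<dots> = (\<Sum>(i, j)\<in>P. a (i, j) * (bivector (axis i 1) (axis j 1) (p y) $ k))"
      using y by (simp add: sum_fun_apply scaleR_fun_def linear_field_def case_prod_unfold)
    also have "\<dots> = (\<Sum>(i, j)\<in>P. (a (i, j) *\<^sub>R
        ((if i = k then axis j 1 else 0) - (if j = k then axis i 1 else 0))) \<bullet> p y)"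
      by (intro sum.cong) (auto simp: bivector_def inner_axis inner_axis' axis inner_diff_left)
    also have "\<dots> = c \<bullet> p y"
      unfolding c_def by (simp add: inner_sum_left case_prod_unfold)
    finally show ?thesis by simp
  qed
  have "c \<bullet> p y = 0" if "y \<in> cone" for y
  proof -
    obtain t z where t: "t > 0" and z: "z \<in> indicatrix F" and yz: "y = t *\<^sub>R z"
      using cone_over_indicatrix[OF \<open>y \<in> cone\<close>] by blast
    show ?thesis
      unfolding yz gradient_homogeneous[OF cone_nonzero[OF indicatrix_cone[OF z]] t]
      using on_indicatrix[OF z] by simp
  qed
  then have "c = 0" by (rule linear_form_vanishes)
  then have "0 = c $ l" by simp
  also have "\<dots> = (\<Sum>r\<in>P. if r = q then a q else 0)"
    unfolding c_def sum_component
  proof (rule sum.cong[OF refl])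
    fix r assume "r \<in> P"
    then obtain i j where r: "r = (i, j)" "f i < f j" using P by blast
    have ne: "\<not> (i = l \<and> j = k)" "\<not> (i = k \<and> j = k)" using r(2) kl(2) by auto
    show "(case r of (i, j) \<Rightarrow> a (i, j) *\<^sub>R
        ((if i = k then axis j 1 else 0) - (if j = k then axis i 1 else 0))) $ l = (if r = q then a q else 0)"
      unfolding r(1) kl(1) using ne by (cases "i = k"; cases "j = k") (auto simp: axis)
  qed
  also have "\<dots> = a q" using q by simp
  finally show ?thesis by simp
qed

lemma edim_gt_if_closed:
  fixes R :: "(real^'n \<Rightarrow> real^'n) set"
  assumes n: "CARD('n) > 2" and F: "\<not> semi_euclidean F"
    and R: "subspace R" "\<And>\<xi> \<eta>. \<xi> \<in> R \<Longrightarrow> \<eta> \<in> R \<Longrightarrow> field_bracket F \<xi> \<eta> \<in> R"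
    and gen: "\<And>X Y. linear_field (bivector X Y) \<in> R"
  shows "edim R > enat (CARD('n) * (CARD('n) - 1) div 2)"
proof (rule ccontr)
  assume "\<not> edim R > enat (CARD('n) * (CARD('n) - 1) div 2)"
  moreover obtain f :: "'n \<Rightarrow> nat" where f: "inj f"
    using inj_to_nat by blast
  define P where "P = {(i, j). f i < f j}"
  have card: "card P = CARD('n) * (CARD('n) - 1) div 2"
    unfolding P_def by (rule card_less_pairs[OF f])
  have fin: "finite P" by simp
  note indep = rotations_independent[OF f P_def]
  have inj: "inj_on rotation P"
  proof (rule inj_onI, rule ccontr)
    fix q r assume q: "q \<in> P" and r: "r \<in> P" and eq: "rotation q = rotation r" and ne: "q \<noteq> r"
    \<comment> \<open>Equal fields with different indices would satisfy a relation with coefficients \<open>1\<close> and \<open>- 1\<close>.\<close>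
    let ?a = "\<lambda>s. if s = q then 1 else if s = r then - 1 else (0::real)"
    have "(\<Sum>s\<in>P. ?a s *\<^sub>R rotation s)
        = (\<Sum>s\<in>P. (if s = q then rotation q else 0) - (if s = r then rotation r else 0))"
      using ne by (intro sum.cong) auto
    also have "\<dots> = 0" using q r eq by (simp add: sum_subtractf)
    finally show False using indep[of ?a q] q by simp
  qed
  have "independent (rotation ` P)"
  proof (rule independent_if_scalars_zero)
    show "finite (rotation ` P)" using fin by simp
  next
    fix a x assume s: "(\<Sum>x\<in>rotation ` P. a x *\<^sub>R x) = 0" and "x \<in> rotation ` P"
    then obtain q where q: "q \<in> P" "x = rotation q" by blast
    have "(\<Sum>q\<in>P. a (rotation q) *\<^sub>R rotation q) = 0"
      using s by (simp add: sum.reindex[OF inj])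
    from indep[OF this q(1)] show "a x = 0" using q(2) by simp
  qed
  moreover have "rotation ` P \<subseteq> R" using gen by auto
  moreover have "card (rotation ` P) = card P" by (rule card_image[OF inj])
  ultimately have "R \<subseteq> span (rotation ` P)"
    using subset_span_if_edim_le_card[of R "rotation ` P"] fin card by simp
  also have "\<dots> \<subseteq> {linear_field C | C. linear C}"
    using linear_bivector by (intro span_minimal subspace_linear_fields) auto
  finally have "\<exists>C. linear C \<and>
      field_bracket F (linear_field (bivector X Y)) (linear_field (bivector Z W)) = linear_field C" for X Y Z W
    using R(2)[OF gen gen, of X Y Z W] by blast
  then have "semi_euclidean F" by (rule semi_euclidean_if_brackets_linear[OF n])
  with F show False by simp
qed

end

text \<open>By Euler's relation \<open>g\<^sub>j\<^sub>m y\<^sup>m\<close> is half of the \<open>j\<close>-th component of the gradient, so the curvature tensor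
  contracted with \<open>X\<close> and \<open>Y\<close> is \<open>\<kappa> / 2\<close> times the bivector \<open>X \<and> Y\<close> applied to the gradient.\<close>

lemma curvature_field_eq_linear_field:
  fixes L :: "real^'n::finite \<Rightarrow> real^'n \<Rightarrow> real"
  assumes mink: "minkowski_space (L x)"
    and curv: "\<And>y i j k. y \<noteq> 0 \<Longrightarrow> curvature L k i j x y =
        \<kappa> * ((if k = i then 1 else 0) * (\<Sum>m\<in>UNIV. metric L x y $ j $ m * y $ m)
           - (if k = j then 1 else 0) * (\<Sum>m\<in>UNIV. metric L x y $ i $ m * y $ m))"
  shows "curvature_field L x X Y = (\<kappa> / 2) *\<^sub>R minkowski_space.linear_field (L x) (bivector X Y)"
proof
  interpret minkowski_space "L x" by (rule mink)
  fix y
  show "curvature_field L x X Y y = ((\<kappa> / 2) *\<^sub>R linear_field (bivector X Y)) y"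
  proof (cases "y \<in> indicatrix (L x)")
    case False
    then show ?thesis
      unfolding curvature_field_def linear_field_def scaleR_fun_def by (simp only: if_False scaleR_zero_right)
  next
    case True
    then have y0: "y \<noteq> 0" by (intro cone_nonzero indicatrix_cone)
    have low: "(\<Sum>m\<in>UNIV. metric L x y $ j $ m * y $ m) = 1/2 * p y $ j" for j
    proof -
      have comp: "metric L x y $ j $ m = 1/2 * H y (axis j 1) $ m" for m
        unfolding metric_def by (simp only: vec_lambda_beta fund_form_eq_hessian[OF y0] inner_axis)
           (simp only: inner_real_def mult_1_right)
      have "(\<Sum>m\<in>UNIV. metric L x y $ j $ m * y $ m) = 1/2 * (H y (axis j 1) \<bullet> y)"
        unfolding comp inner_vec_def sum_distrib_left by (intro sum.cong) auto
      also have "\<dots> = 1/2 * p y $ j"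
        using hessian_symmetric[OF y0, of "axis j 1" y] euler_gradient[OF y0] by (simp add: inner_axis)
      finally show ?thesis .
    qed
    have "(\<Sum>i\<in>UNIV. \<Sum>j\<in>UNIV. curvature L k i j x y * X $ i * Y $ j)
        = \<kappa> / 2 * (X $ k * (p y \<bullet> Y) - Y $ k * (p y \<bullet> X))" for k
    proof -
      have "(\<Sum>i\<in>UNIV. \<Sum>j\<in>UNIV. curvature L k i j x y * X $ i * Y $ j)
        = (\<Sum>i\<in>UNIV. \<Sum>j\<in>UNIV. (if k = i then \<kappa> / 2 * (p y $ j * X $ i * Y $ j) else 0)
             - (if k = j then \<kappa> / 2 * (p y $ i * X $ i * Y $ j) else 0))"
        unfolding curv[OF y0] low by (intro sum.cong) (auto simp: algebra_simps)
      also have "\<dots> = (\<Sum>j\<in>UNIV. \<kappa> / 2 * (p y $ j * X $ k * Y $ j)) - (\<Sum>i\<in>UNIV. \<kappa> / 2 * (p y $ i * X $ i * Y $ k))"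
        unfolding sum_subtractf by (subst sum.swap) simp
      also have "\<dots> = \<kappa> / 2 * (X $ k * (p y \<bullet> Y) - Y $ k * (p y \<bullet> X))"
        by (simp add: inner_vec_def sum_distrib_left right_diff_distrib mult_ac)
      finally show ?thesis .
    qed
    then show ?thesis
      using True by (simp add: curvature_field_def linear_field_def scaleR_fun_def bivector_def vec_eq_iff mult_ac)
  qed
qed

theorem theorem15:
  fixes A :: "('m::{t2_space, second_countable_topology}, 'n::finite) chart set"
    and F :: "'m \<Rightarrow> ('m, 'n) tangent \<Rightarrow> real"
    and \<kappa> :: real
    and p :: 'm
  assumes "finsler_manifold A F"
    and "constant_curvature A F \<kappa>" and "\<kappa> \<noteq> 0"
    and "CARD('n) > 2"
    and "\<not> semi_riemannian_point A F p"
  shows "\<forall>c\<in>A. p \<in> fst c \<longrightarrow>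
    edim (curvature_algebra (in_coords A F c) (snd c p)) > enat (CARD('n) * (CARD('n) - 1) div 2)"
proof (intro ballI impI)
  fix c assume c: "c \<in> A" "p \<in> fst c"
  let ?L = "in_coords A F c" and ?x = "snd c p"
  let ?R = "curvature_algebra ?L ?x"
  have x: "?x \<in> chart_image c" using c(2) by (simp add: chart_image_def)
  have "minkowski_functional (?L ?x)"
    using assms(1) c(1) x unfolding finsler_manifold_def by blast
  then interpret minkowski_space "?L ?x" by unfold_locales
  have curv: "curvature ?L k i j ?x y =
        \<kappa> * ((if k = i then 1 else 0) * (\<Sum>m\<in>UNIV. metric ?L ?x y $ j $ m * y $ m)
           - (if k = j then 1 else 0) * (\<Sum>m\<in>UNIV. metric ?L ?x y $ i $ m * y $ m))"
    if "y \<noteq> 0" for y i j k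
    using assms(2) c(1) x that unfolding constant_curvature_def Let_def by blast
  have R: "subspace ?R"
    unfolding curvature_algebra_def by (rule subspace_lie_hull)
  have gen: "linear_field (bivector X Y) \<in> ?R" for X Y
  proof -
    have "curvature_field ?L ?x X Y \<in> ?R"
      unfolding curvature_algebra_def by (rule hull_inc) blast
    then have "(2 / \<kappa>) *\<^sub>R curvature_field ?L ?x X Y \<in> ?R"
      by (rule subspace_scale[OF R])
    moreover have "curvature_field ?L ?x X Y = (\<kappa> / 2) *\<^sub>R linear_field (bivector X Y)"
      by (rule curvature_field_eq_linear_field[OF minkowski_space_axioms curv])
    ultimately show ?thesis using \<open>\<kappa> \<noteq> 0\<close> by simp
  qed
  show "edim ?R > enat (CARD('n) * (CARD('n) - 1) div 2)"
  proof (rule edim_gt_if_closed[OF assms(4) _ R _ gen])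
    show "\<not> semi_euclidean (?L ?x)"
      using assms(5) c unfolding semi_riemannian_point_def by blast
  qed (unfold curvature_algebra_def, rule bracket_lie_hull)
qed

end
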